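(* Define $\bar\theta_1:[0,+\infty)\to[0,+\infty)$ by $\bar\theta_1(t)=t$. Suppose that $\theta_1$ is locally Lipschitz continuous with $\bar\eta:=\inf\{\eta\in\partial^c\theta_1(t):t\in[0,+\infty)\}>0$, let $\tilde\eta\in(0,\bar\eta]$, and let the constants $\rho,\bar\rho$ satisfy $0<\rho\le\min\{\tilde\eta,1\}\,\bar\rho$. For any given $\gamma,\varsigma>0$ and $l,u\in\mathbb{R}^p$ with $l\le\bm 0\le u$, it holds that for any $z\in\mathbb{R}^p$: - if $\|z\|_1\le\gamma/\bar\rho$, then $\mathrm{prox}_{\gamma\theta_1(\|\cdot\|_1/\rho)+\delta_{[l,u]}(\cdot)}(z)=\mathrm{prox}_{\gamma\bar\theta_1(\|\cdot\|_1/\bar\rho)+\delta_{[l,u]}(\cdot)}(z)=\bm 0$; - if $\|z\|_2\le\gamma/\bar\rho$, then $\mathrm{prox}_{\gamma\theta_1(\|\cdot\|_2/\rho)+\delta_{B_\varsigma}(\cdot)}(z)=\mathrm{prox}_{\gamma\bar\theta_1(\|\cdot\|_2/\bar\rho)+\delta_{B_\varsigma}(\cdot)}(z)=\bm 0$.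
   Context: $\theta_1:[0,+\infty)\to[0,+\infty)$ is a function with $\theta_1(0)=0$, $\theta_1(1)=1$, $\theta_1(t)\in(0,1)$ for $t\in(0,1)$, and $\theta_1(t)>1$ for $t>1$. $\partial^c$ is the Clarke subdifferential (at $t=0$ understood one-sidedly, through limits of derivatives at points $t_j\downarrow0$). $p$ is a positive integer; $[l,u]=\{x\in\mathbb{R}^p:l\le x\le u\}$ componentwise; $B_\varsigma=\{x\in\mathbb{R}^p:\|x\|_2\le\varsigma\}$; $\delta_\Omega$ is the indicator function ($0$ on $\Omega$, $+\infty$ off $\Omega$). $\mathrm{prox}_h(z):=\mathrm{argmin}_x\{h(x)+\frac12\|x-z\|_2^2\}$ (the set of minimizers); "$=\bm 0$" means that $\bm 0$ is the unique minimizer. *)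

theory Defs
  imports "HOL-Analysis.Analysis"
begin

(* The library notion concerns families indexed by a parameter; the parameter is a dummy here. *)
definition locally_lipschitz_on :: "real set \<Rightarrow> (real \<Rightarrow> real) \<Rightarrow> bool" where
  "locally_lipschitz_on S f \<longleftrightarrow> local_lipschitz (UNIV :: real set) S (\<lambda>_. f)"

(* As in Clarke's definition, the base point y ranges over nhds t, so y = t is allowed. *)
definition clarke_dderiv :: "(real \<Rightarrow> real) \<Rightarrow> real \<Rightarrow> real \<Rightarrow> ereal" where
  "clarke_dderiv f t v =
     Limsup (nhds t \<times>\<^sub>F at_right 0) (\<lambda>(y, h). ereal ((f (y + h * v) - f y) / h))"

definition limiting_right_derivs :: "(real \<Rightarrow> real) \<Rightarrow> real \<Rightarrow> real set" where
  "limiting_right_derivs f t =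
     {\<xi>. \<exists>s d. (\<forall>j. s j > t \<and> (f has_real_derivative d j) (at (s j)))
            \<and> s \<longlonglongrightarrow> t \<and> d \<longlonglongrightarrow> \<xi>}"

(* For a function on [0, oo), represented by a total function whose values on the negative
   axis are irrelevant.  At t > 0 this is Clarke's generalized gradient, defined by the
   generalized directional derivative.  At t = 0 only points of the domain are available,
   and the one-sided gradient is the convex hull of the limits of derivatives at points
   decreasing to 0.  The value for t < 0 is never used. *)
definition clarke_subdiff :: "(real \<Rightarrow> real) \<Rightarrow> real \<Rightarrow> real set" where
  "clarke_subdiff f t =
     (if t > 0 then {\<xi>. \<forall>v. ereal (\<xi> * v) \<le> clarke_dderiv f t v}
      else if t = 0 then convex hull (limiting_right_derivs f 0)
      else {})"

definition norm1 :: "real ^ 'n \<Rightarrow> real" where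
  "norm1 x = (\<Sum>i\<in>UNIV. \<bar>x $ i\<bar>)"

definition indicator_fun :: "'a set \<Rightarrow> 'a \<Rightarrow> ereal" where
  "indicator_fun \<Omega> x = (if x \<in> \<Omega> then 0 else \<infinity>)"

definition prox :: "('a::real_normed_vector \<Rightarrow> ereal) \<Rightarrow> 'a \<Rightarrow> 'a set" where
  "prox h z = {x. is_arg_min (\<lambda>x. h x + ereal (1 / 2 * (norm (x - z))\<^sup>2)) (\<lambda>_. True) x}"

end

theory Submission
  imports Defs
begin

text \<open>
  The lower end of the Clarke subdifferential of \<open>\<theta>\<close> at \<open>t > 0\<close> is minus the generalized
  derivative in direction \<open>-1\<close>, so a lower bound \<open>\<eta>\<close> on all subgradients bounds the difference
  quotients of \<open>\<theta>\<close> from below, up to an arbitrarily small error, near every point. By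
  compactness these local bounds chain together, and \<open>\<theta> t \<ge> \<eta> t\<close> for \<open>t \<ge> 0\<close>. Hence
  \<open>\<gamma> \<theta>(\<parallel>x\<parallel> / \<rho>) \<ge> (\<gamma> / \<rho>bar) \<parallel>x\<parallel> \<ge> x \<bullet> z\<close>: the vector \<open>z\<close> is a convex subgradient of the
  penalty at its minimizer \<open>0\<close>, which says that the proximal point of \<open>z\<close> is \<open>0\<close>.
\<close>

section \<open>Clarke's directional derivative and difference quotients\<close>

lemma eventually_nhds_times_at_right_0:
  fixes t :: real
  shows "eventually P (nhds t \<times>\<^sub>F at_right (0::real)) \<longleftrightarrow>
    (\<exists>d>0. \<forall>y h. \<bar>y - t\<bar> < d \<and> 0 < h \<and> h < d \<longrightarrow> P (y, h))"
proof
  assume "eventually P (nhds t \<times>\<^sub>F at_right (0::real))"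
  then obtain A B where A: "eventually A (nhds t)" and B: "eventually B (at_right (0::real))"
    and AB: "\<And>y h. A y \<Longrightarrow> B h \<Longrightarrow> P (y, h)"
    unfolding eventually_prod_filter by auto
  from A obtain d where d: "d > 0" "\<And>y. \<bar>y - t\<bar> < d \<Longrightarrow> A y"
    by (auto simp: eventually_nhds_metric dist_real_def)
  from B obtain e where e: "e > 0" "\<And>h. 0 < h \<Longrightarrow> h < e \<Longrightarrow> B h"
    by (auto simp: eventually_at_right_field)
  show "\<exists>d>0. \<forall>y h. \<bar>y - t\<bar> < d \<and> 0 < h \<and> h < d \<longrightarrow> P (y, h)"
    by (rule exI[of _ "min d e"]) (use d e AB in auto)
next
  assume "\<exists>d>0. \<forall>y h. \<bar>y - t\<bar> < d \<and> 0 < h \<and> h < d \<longrightarrow> P (y, h)"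
  then obtain d where d: "d > 0"
    and P: "\<And>y h. \<bar>y - t\<bar> < d \<Longrightarrow> 0 < h \<Longrightarrow> h < d \<Longrightarrow> P (y, h)"
    by blast
  have "eventually (\<lambda>y. \<bar>y - t\<bar> < d) (nhds t)"
    using d by (auto simp: eventually_nhds_metric dist_real_def)
  moreover have "eventually (\<lambda>h. 0 < h \<and> h < d) (at_right 0)"
    using d by (auto simp: eventually_at_right_field)
  ultimately show "eventually P (nhds t \<times>\<^sub>F at_right (0::real))"
    unfolding eventually_prod_filter using P by blast
qed

lemma clarke_dderiv_le:
  assumes "d > 0"
    and "\<And>y h. \<bar>y - t\<bar> < d \<Longrightarrow> 0 < h \<Longrightarrow> h < d \<Longrightarrow> f (y + h * v) - f y \<le> M * h"
  shows "clarke_dderiv f t v \<le> ereal M"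
  unfolding clarke_dderiv_def
  by (rule Limsup_bounded)
    (use assms in \<open>auto simp: eventually_nhds_times_at_right_0 field_simps intro!: exI[of _ d]\<close>)

text \<open>The bound is assumed at all nearby base points and steps, so it already bounds the
  \<open>Liminf\<close>, which lies below the \<open>Limsup\<close> because the product filter is
  nontrivial.\<close>

lemma le_clarke_dderiv:
  assumes "d > 0"
    and "\<And>y h. \<bar>y - t\<bar> < d \<Longrightarrow> 0 < h \<Longrightarrow> h < d \<Longrightarrow> M * h \<le> f (y + h * v) - f y"
  shows "ereal M \<le> clarke_dderiv f t v"
proof -
  let ?F = "nhds t \<times>\<^sub>F at_right (0::real)"
  let ?q = "\<lambda>(y, h). ereal ((f (y + h * v) - f y) / h)"
  have ne: "?F \<noteq> bot"
    by (simp add: prod_filter_eq_bot)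
  have "ereal M \<le> Liminf ?F ?q"
    by (rule Liminf_bounded)
      (use assms in \<open>auto simp: eventually_nhds_times_at_right_0 field_simps intro!: exI[of _ d]\<close>)
  also have "\<dots> \<le> Limsup ?F ?q"
    by (rule Liminf_le_Limsup[OF ne])
  finally show ?thesis
    by (simp add: clarke_dderiv_def)
qed

lemma clarke_dderiv_lessE:
  assumes "clarke_dderiv f t v < ereal M"
  obtains d where "d > 0"
    and "\<And>y h. \<bar>y - t\<bar> < d \<Longrightarrow> 0 < h \<Longrightarrow> h < d \<Longrightarrow> f (y + h * v) - f y < M * h"
proof -
  have "eventually (\<lambda>(y, h). (f (y + h * v) - f y) / h < M) (nhds t \<times>\<^sub>F at_right 0)"
    using Limsup_lessD[OF assms[unfolded clarke_dderiv_def]]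
    by (simp add: case_prod_unfold)
  then obtain d where "d > 0"
    "\<And>y h. \<bar>y - t\<bar> < d \<Longrightarrow> 0 < h \<Longrightarrow> h < d \<Longrightarrow> (f (y + h * v) - f y) / h < M"
    by (auto simp: eventually_nhds_times_at_right_0)
  then show ?thesis
    by (intro that[of d]) (auto simp: pos_divide_less_eq)
qed

lemma clarke_dderiv_finite:
  assumes "d > 0" "L-lipschitz_on (ball t d) f"
  shows "\<bar>clarke_dderiv f t (- 1)\<bar> \<noteq> \<infinity>"
proof -
  \<comment> \<open>Halving \<open>d\<close> keeps both \<open>y\<close> and \<open>y - h\<close>
    inside the ball where \<open>f\<close> is Lipschitz.\<close>
  have *: "\<bar>f (y + h * - 1) - f y\<bar> \<le> L * h" if "\<bar>y - t\<bar> < d / 2" "0 < h" "h < d / 2" for y h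
  proof -
    have "y + h * - 1 \<in> ball t d" "y \<in> ball t d"
      using that unfolding mem_ball dist_real_def by linarith+
    from lipschitz_onD[OF assms(2) this] show ?thesis
      using that by (simp add: dist_real_def)
  qed
  have "clarke_dderiv f t (- 1) \<le> ereal L"
    by (rule clarke_dderiv_le[of "d / 2"]) (use assms(1) * in \<open>auto simp: abs_le_iff\<close>)
  moreover have "ereal (- L) \<le> clarke_dderiv f t (- 1)"
    by (rule le_clarke_dderiv[of "d / 2"]) (use assms(1) * in \<open>auto simp: abs_le_iff\<close>, smt)
  ultimately show ?thesis
    by auto
qed

section \<open>From Clarke subgradients to linear growth\<close>

text \<open>This is Hahn-Banach in dimension one: the directional derivative is sublinear in
  \<open>v\<close>, and the linear function \<open>- D * v\<close> touches it at
  \<open>v = - 1\<close>, hence lies below it everywhere. Each sign of \<open>v\<close> is checked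
  directly on difference quotients.\<close>

lemma uminus_clarke_dderiv_in_subdiff:
  assumes "t > 0" and D: "clarke_dderiv f t (- 1) = ereal D"
  shows "- D \<in> clarke_subdiff f t"
proof -
  have "ereal (- D * v) \<le> clarke_dderiv f t v" for v
  proof (rule ccontr)
    assume "\<not> ereal (- D * v) \<le> clarke_dderiv f t v"
    then obtain M where M: "clarke_dderiv f t v < ereal M" "M < - D * v"
      using ereal_dense2[of "clarke_dderiv f t v" "ereal (- D * v)"]
      by (metis ereal_less_eq(3) not_le)
    from M(1) obtain d where d: "d > 0"
      and less: "\<And>y h. \<bar>y - t\<bar> < d \<Longrightarrow> 0 < h \<Longrightarrow> h < d \<Longrightarrow> f (y + h * v) - f y < M * h"
      by (rule clarke_dderiv_lessE) blast
    consider "v < 0" | "v = 0" | "v > 0"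
      by linarith
    then show False
    proof cases
      \<comment> \<open>Positive homogeneity: a step \<open>h\<close> in direction
        \<open>- 1\<close> is a step \<open>h / - v\<close> in direction \<open>v\<close>.\<close>
      assume v: "v < 0"
      have "clarke_dderiv f t (- 1) \<le> ereal (M / - v)"
      proof (rule clarke_dderiv_le)
        show "min d (d * - v) > 0"
          using d v by (simp add: mult_pos_neg)
        fix y h assume h: "\<bar>y - t\<bar> < min d (d * - v)" "0 < h" "h < min d (d * - v)"
        have "f (y + h / - v * v) - f y < M * (h / - v)"
          using h v by (intro less) (auto simp: field_simps)
        then show "f (y + h * - 1) - f y \<le> M / - v * h"
          using v by simp
      qed
      then show False
        using D M(2) v by (simp add: field_simps)
    next
      assume "v = 0"
      then show False
        using less[of t "d / 2"] d M(2) by (simp add: mult_less_0_iff zero_less_mult_iff)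
    next
      assume v: "v > 0"
      \<comment> \<open>Moving the base point from \<open>y\<close> to \<open>y - h\<close> reverses
        the direction: a step \<open>h / v\<close> along \<open>v\<close> leads from
        \<open>y - h\<close> back to \<open>y\<close>. The bound \<open>d / 2\<close> keeps
        \<open>y - h\<close> within \<open>d\<close> of \<open>t\<close>, and
        \<open>d * v / 2\<close> keeps \<open>h / v\<close> below \<open>d\<close>.\<close>
      define e where "e = min (d / 2) (d * v / 2)"
      have e: "e > 0" "e \<le> d / 2" "e \<le> d * v / 2"
        using d v by (auto simp: e_def)
      have "ereal (- M / v) \<le> clarke_dderiv f t (- 1)"
      proof (rule le_clarke_dderiv[OF e(1)])
        fix y h assume h: "\<bar>y - t\<bar> < e" "0 < h" "h < e"
        have "h < d * v"
          using h(2,3) e(3) by linarith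
        then have "f (y - h + h / v * v) - f (y - h) < M * (h / v)"
          using h v e by (intro less) (auto simp: field_simps abs_less_iff)
        then show "- M / v * h \<le> f (y + h * - 1) - f y"
          using v by simp
      qed
      then show False
        using D M(2) v by (simp add: field_simps)
    qed
  qed
  then show ?thesis
    using assms(1) by (simp add: clarke_subdiff_def)
qed

text \<open>With \<open>D\<close> the derivative in direction \<open>- 1\<close>, the subgradient
  \<open>- D\<close> satisfies \<open>\<eta> \<le> - D\<close>, so \<open>D < - c\<close>. The
  strict gap turns a bound on the \<open>Limsup\<close> into one on all difference quotients near
  \<open>t\<close>, uniformly in the base point.\<close>

lemma clarke_subdiff_lower_bound_local:
  assumes "t > 0" "d > 0" "L-lipschitz_on (ball t d) f"
    and "\<And>\<xi>. \<xi> \<in> clarke_subdiff f t \<Longrightarrow> \<eta> \<le> \<xi>" and "c < \<eta>"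
  obtains e where "e > 0"
    and "\<And>y h. \<bar>y - t\<bar> < e \<Longrightarrow> 0 < h \<Longrightarrow> h < e \<Longrightarrow> c * h < f y - f (y - h)"
proof -
  obtain D where D: "clarke_dderiv f t (- 1) = ereal D"
    using clarke_dderiv_finite[OF assms(2,3)] by (cases "clarke_dderiv f t (- 1)") auto
  with assms(1,4,5) have "clarke_dderiv f t (- 1) < ereal (- c)"
    using uminus_clarke_dderiv_in_subdiff by fastforce
  then obtain e where "e > 0"
    "\<And>y h. \<bar>y - t\<bar> < e \<Longrightarrow> 0 < h \<Longrightarrow> h < e \<Longrightarrow> f (y + h * - 1) - f y < - c * h"
    by (rule clarke_dderiv_lessE) blast
  then show ?thesis
    by (intro that[of e]) (auto, smt)
qed

lemma clarke_subdiff_lower_bound_increment: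
  assumes "0 < a" "a \<le> b"
    and lip: "locally_lipschitz_on {0..} f"
    and lb: "\<And>t \<xi>. t > 0 \<Longrightarrow> \<xi> \<in> clarke_subdiff f t \<Longrightarrow> \<eta> \<le> \<xi>"
  shows "\<eta> * (b - a) \<le> f b - f a"
proof -
  have incr: "c * (b - a) \<le> f b - f a" if c: "c < \<eta>" for c
    using \<open>a \<le> b\<close>
  \<comment> \<open>The increment inequality is additive over adjacent intervals, so it suffices to
    prove it on short intervals around each point.\<close>
  proof (induction rule: Bolzano)
    case (trans a b c')
    then show ?case
      by (simp add: algebra_simps)
  next
    case (local t)
    then have t: "t > 0"
      using \<open>0 < a\<close> by linarith
    then obtain u L where u: "u > 0" "L-lipschitz_on (cball t u \<inter> {0..}) f"
      using lip unfolding locally_lipschitz_on_def local_lipschitz_def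
      by (metis IntI UNIV_I atLeast_iff cball_eq_empty centre_in_cball less_imp_le not_less)
    \<comment> \<open>Radius at most \<open>t\<close> keeps the ball inside the domain
      \<open>{0..}\<close>.\<close>
    have "L-lipschitz_on (ball t (min u t)) f"
      by (rule lipschitz_on_subset[OF u(2)]) (auto simp: dist_real_def)
    then obtain e where e: "e > 0"
      "\<And>y h. \<bar>y - t\<bar> < e \<Longrightarrow> 0 < h \<Longrightarrow> h < e \<Longrightarrow> c * h < f y - f (y - h)"
      using clarke_subdiff_lower_bound_local[of t "min u t" L f \<eta> c] t u(1) lb c by auto
    \<comment> \<open>The local bound is applied backwards from \<open>y\<close>, which is within
      \<open>e\<close> of \<open>t\<close>; the step \<open>y - x\<close> must be positive, so
      \<open>x = y\<close> is separate.\<close>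
    have "c * (y - x) \<le> f y - f x" if "x \<le> t" "t \<le> y" "y - x < e" for x y
      using e(2)[of y "y - x"] that by (cases "x = y") auto
    then show ?case
      using e(1) by blast
  qed
  show ?thesis
  proof (cases "a = b")
    case False
    then have "a < b"
      using \<open>a \<le> b\<close> by simp
    have "\<eta> \<le> (f b - f a) / (b - a)"
      \<comment> \<open>Every \<open>c < \<eta>\<close> bounds the quotient from below, hence so
        does \<open>\<eta>\<close>.\<close>
      by (rule dense_le) (use incr \<open>a < b\<close> in \<open>simp add: field_simps\<close>)
    then show ?thesis
      using \<open>a < b\<close> by (simp add: field_simps)
  qed simp
qed

text \<open>The increment bound holds on intervals starting at \<open>a > 0\<close>; letting
  \<open>a\<close> decrease to 0 and using continuity of \<open>f\<close> at 0 extends it to the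
  origin.\<close>

lemma clarke_subdiff_lower_bound_linear:
  assumes "t \<ge> 0" "f 0 = 0"
    and lip: "locally_lipschitz_on {0..} f"
    and lb: "\<And>t \<xi>. t > 0 \<Longrightarrow> \<xi> \<in> clarke_subdiff f t \<Longrightarrow> \<eta> \<le> \<xi>"
  shows "\<eta> * t \<le> f t"
proof (cases "t = 0")
  case False
  then have t: "t > 0"
    using assms(1) by simp
  have "continuous_on {0..} f"
    using local_lipschitz_continuous_on[OF lip[unfolded locally_lipschitz_on_def]] by simp
  then have "(f \<longlongrightarrow> f 0) (at 0 within {0..})"
    by (simp add: continuous_on_def)
  then have lim: "(f \<longlongrightarrow> 0) (at_right 0)"
    using assms(2) by (auto intro: tendsto_within_subset)
  have lower: "((\<lambda>a. \<eta> * (t - a)) \<longlongrightarrow> \<eta> * (t - 0)) (at_right 0)"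
    by (intro tendsto_intros)
  have upper: "((\<lambda>a. f t - f a) \<longlongrightarrow> f t - 0) (at_right 0)"
    by (intro tendsto_intros lim)
  have "\<eta> * (t - a) \<le> f t - f a" if "0 < a" "a < t" for a
    by (rule clarke_subdiff_lower_bound_increment[OF that(1) less_imp_le[OF that(2)] lip lb])
  then have "\<forall>\<^sub>F a in at_right 0. \<eta> * (t - a) \<le> f t - f a"
    unfolding eventually_at_right_field using t by blast
  then have "\<eta> * (t - 0) \<le> f t - 0"
    by (rule tendsto_le[OF trivial_limit_at_right_real upper lower])
  then show ?thesis
    by simp
qed (use assms(2) in simp)

section \<open>Proximal points at the origin\<close>

text \<open>Expanding the square shows that the objective at \<open>x\<close> exceeds its value at 0
  by at least half of the squared norm of \<open>x\<close>. Existence and uniqueness of the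
  minimizer follow together.\<close>

lemma prox_eq_zero:
  fixes z :: "'a::real_inner"
  assumes "h 0 = 0" and le: "\<And>x. ereal (x \<bullet> z) \<le> h x"
  shows "prox h z = {0}"
proof -
  let ?F = "\<lambda>x. h x + ereal (1 / 2 * (norm (x - z))\<^sup>2)"
  have F0: "?F 0 = ereal (1 / 2 * (norm z)\<^sup>2)"
    by (simp add: assms(1))
  \<comment> \<open>The growth estimate is a sum rather than a difference, since \<open>h x\<close>
    may be infinite.\<close>
  have "ereal (1 / 2 * (norm x)\<^sup>2) + ?F 0 \<le> ?F x" for x
  proof -
    have "ereal (1 / 2 * (norm x)\<^sup>2) + ?F 0 = ereal (x \<bullet> z) + ereal (1 / 2 * (norm (x - z))\<^sup>2)"
      unfolding F0 by (simp add: power2_norm_eq_inner inner_diff inner_commute field_simps)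
    also have "\<dots> \<le> ?F x"
      by (intro add_right_mono le)
    finally show ?thesis .
  qed
  then have *: "ereal (1 / 2 * (norm x)\<^sup>2 + 1 / 2 * (norm z)\<^sup>2) \<le> ?F x" for x
    by (metis F0 plus_ereal.simps(1))
  have "?F 0 < ?F x" if "x \<noteq> 0" for x
    unfolding F0 using that by (intro less_le_trans[OF _ *]) simp
  then have "(\<nexists>y. ?F y < ?F x) \<longleftrightarrow> x = 0" for x
    by (metis less_asym less_irrefl)
  then show ?thesis
    unfolding prox_def is_arg_min_def by simp
qed

text \<open>The indicator vanishes at 0 and is nonnegative, so adding it preserves both the value at
  0 and the linear lower bound.\<close>

lemma prox_penalty_eq_zero:
  fixes z :: "'a::real_inner"
  assumes "0 \<in> \<Omega>" "\<phi> 0 = 0" and "\<And>x. x \<bullet> z \<le> \<phi> x"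
  shows "prox (\<lambda>x. ereal (\<phi> x) + indicator_fun \<Omega> x) z = {0}"
  by (rule prox_eq_zero) (use assms in \<open>auto simp: indicator_fun_def zero_ereal_def\<close>)

text \<open>Cauchy-Schwarz, with each Euclidean norm bounded by the 1-norm. This gives
  \<open>norm1\<close> the same inequality that \<open>norm\<close> satisfies, so one argument
  covers both penalties.\<close>

lemma inner_le_norm1:
  fixes x z :: "real ^ 'n"
  shows "x \<bullet> z \<le> norm1 x * norm1 z"
proof -
  have "norm x * norm z \<le> norm1 x * norm1 z"
    unfolding norm1_def
    by (intro mult_mono norm_le_l1_cart) (auto intro: sum_nonneg)
  then show ?thesis
    using norm_cauchy_schwarz[of x z] by linarith
qed

theorem proposition8:
  fixes \<theta> \<theta>bar :: "real \<Rightarrow> real"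
    and \<eta>bar :: ereal
    and \<eta>tilde \<rho> \<rho>bar \<gamma> \<sigma> :: real
    and l u z :: "real ^ 'p"
  assumes theta_nonneg: "\<forall>t\<ge>0. \<theta> t \<ge> 0"
    and theta_0: "\<theta> 0 = 0"
    and theta_1: "\<theta> 1 = 1"
    and theta_less: "\<forall>t. 0 < t \<and> t < 1 \<longrightarrow> 0 < \<theta> t \<and> \<theta> t < 1"
    and theta_greater: "\<forall>t>1. \<theta> t > 1"
    and thetabar: "\<forall>t\<ge>0. \<theta>bar t = t"
    and lipschitz: "locally_lipschitz_on {0..} \<theta>"
    and etabar: "\<eta>bar = Inf (ereal ` (\<Union>t\<in>{0..}. clarke_subdiff \<theta> t))"
    and etabar_pos: "\<eta>bar > 0"
    and etatilde: "0 < \<eta>tilde" "ereal \<eta>tilde \<le> \<eta>bar"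
    and rho: "0 < \<rho>" "\<rho> \<le> min \<eta>tilde 1 * \<rho>bar"
    and pos: "\<gamma> > 0" "\<sigma> > 0"
    and box: "l \<le> 0" "0 \<le> u"
  shows "(norm1 z \<le> \<gamma> / \<rho>bar \<longrightarrow>
            prox (\<lambda>x. ereal (\<gamma> * \<theta> (norm1 x / \<rho>)) + indicator_fun {l..u} x) z = {0} \<and>
            prox (\<lambda>x. ereal (\<gamma> * \<theta>bar (norm1 x / \<rho>bar)) + indicator_fun {l..u} x) z = {0})
       \<and> (norm z \<le> \<gamma> / \<rho>bar \<longrightarrow>
            prox (\<lambda>x. ereal (\<gamma> * \<theta> (norm x / \<rho>)) + indicator_fun (cball 0 \<sigma>) x) z = {0} \<and>
            prox (\<lambda>x. ereal (\<gamma> * \<theta>bar (norm x / \<rho>bar)) + indicator_fun (cball 0 \<sigma>) x) z = {0})"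
proof -
  \<comment> \<open>Positivity of \<open>\<rho>bar\<close> is forced by \<open>0 < \<rho>\<close>
    and the upper bound on \<open>\<rho>\<close>.\<close>
  have "min \<eta>tilde 1 * \<rho>bar > 0"
    using rho by linarith
  then have rbar: "\<rho>bar > 0"
    using etatilde(1) by (auto simp: zero_less_mult_iff)
  have "min \<eta>tilde 1 * \<rho>bar \<le> \<eta>tilde * \<rho>bar"
    using rbar by (intro mult_right_mono) auto
  then have rho_le: "\<rho> \<le> \<eta>tilde * \<rho>bar"
    using rho(2) by linarith
  have lb: "\<eta>tilde \<le> \<xi>" if "t > 0" "\<xi> \<in> clarke_subdiff \<theta> t" for t \<xi>
  proof -
    have "\<eta>bar \<le> ereal \<xi>"
      unfolding etabar by (rule Inf_lower) (use that in force)
    then show ?thesis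
      using etatilde(2) order_trans ereal_less_eq(3) by blast
  qed
  \<comment> \<open>The slope \<open>\<eta>tilde\<close> of the linear minorant compensates for the
    change of scale from \<open>\<rho>\<close> to \<open>\<rho>bar\<close>, as
    \<open>\<rho> \<le> \<eta>tilde * \<rho>bar\<close>.\<close>
  have penalty: "s / \<rho>bar \<le> \<theta> (s / \<rho>)" if "s \<ge> 0" for s
  proof -
    have "s / \<rho>bar \<le> \<eta>tilde * (s / \<rho>)"
      using mult_left_mono[OF rho_le that] rho(1) rbar by (simp add: field_simps)
    also have "\<dots> \<le> \<theta> (s / \<rho>)"
      by (rule clarke_subdiff_lower_bound_linear[OF _ theta_0 lipschitz lb]) (use that rho(1) in auto)
    finally show ?thesis .
  qed
  \<comment> \<open>Both claims are instances: \<open>N\<close> is \<open>norm1\<close> with the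
    box, or \<open>norm\<close> with the ball.\<close>
  have prox_zero: "prox (\<lambda>x. ereal (\<gamma> * \<theta> (N x / \<rho>)) + indicator_fun \<Omega> x) z = {0} \<and>
      prox (\<lambda>x. ereal (\<gamma> * \<theta>bar (N x / \<rho>bar)) + indicator_fun \<Omega> x) z = {0}"
    if N: "\<And>x. N x \<ge> 0" "N 0 = 0" and "0 \<in> \<Omega>"
      and dual: "\<And>x. x \<bullet> z \<le> N x * N z" and Nz: "N z \<le> \<gamma> / \<rho>bar"
    for N :: "real ^ 'p \<Rightarrow> real" and \<Omega>
  proof -
    \<comment> \<open>The size condition on \<open>z\<close> enters here: \<open>N x * N z\<close>
      is at most \<open>N x * (\<gamma> / \<rho>bar)\<close>.\<close>
    have *: "x \<bullet> z \<le> \<gamma> * (N x / \<rho>bar)" for x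
      using dual[of x] mult_left_mono[OF Nz N(1)[of x]] by (simp add: mult.commute)
    then have "x \<bullet> z \<le> \<gamma> * \<theta> (N x / \<rho>)" for x
      using mult_left_mono[OF penalty[OF N(1)[of x]], of \<gamma>] pos(1) order_trans by fastforce
    moreover have "x \<bullet> z \<le> \<gamma> * \<theta>bar (N x / \<rho>bar)" for x
      using * thetabar N(1) rbar by simp
    ultimately show ?thesis
      using \<open>0 \<in> \<Omega>\<close> N(2) theta_0 thetabar by (simp add: prox_penalty_eq_zero)
  qed
  show ?thesis
  proof (intro conjI[OF impI impI])
    assume "norm1 z \<le> \<gamma> / \<rho>bar"
    then show "prox (\<lambda>x. ereal (\<gamma> * \<theta> (norm1 x / \<rho>)) + indicator_fun {l..u} x) z = {0} \<and>
        prox (\<lambda>x. ereal (\<gamma> * \<theta>bar (norm1 x / \<rho>bar)) + indicator_fun {l..u} x) z = {0}"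
      by (intro prox_zero inner_le_norm1) (use box in \<open>auto simp: norm1_def sum_nonneg\<close>)
  next
    assume "norm z \<le> \<gamma> / \<rho>bar"
    then show "prox (\<lambda>x. ereal (\<gamma> * \<theta> (norm x / \<rho>)) + indicator_fun (cball 0 \<sigma>) x) z = {0} \<and>
        prox (\<lambda>x. ereal (\<gamma> * \<theta>bar (norm x / \<rho>bar)) + indicator_fun (cball 0 \<sigma>) x) z = {0}"
      by (intro prox_zero norm_cauchy_schwarz) (use pos(2) in auto)
  qed
qed

end
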